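(* Let $0<r<m\le n$ be integers and let $\Omega=\bigcup_{j\in[n]}\omega_j\times\{j\}\subset[m]\times[n]$ with $\omega_j\subset[m]$, $\#\Omega=r(m+n-r)$, and $\#\omega_j=r+1$ for every $j\in[n]$. Then necessarily $n=r(m-r)$, and the following two conditions are equivalent: (a) there is a partition $[n]=\bigcup_{\ell\in[r]}\mathcal{J}_\ell$ such that $\Omega_{\mathcal{J}_\ell}$ is a relaxed $(1,r,m)$-SLMF for every $\ell\in[r]$; (b) $\Omega$ is a relaxed $(r,r,m)$-SLMF.
   Context: Notation: $[s]=\{1,\dots,s\}$; $\#$ denotes cardinality. For $\mathcal{J}\subset[n]$ put $\Omega_{\mathcal{J}}=\bigcup_{j\in\mathcal{J}}\omega_j\times\{j\}$ (so $\Omega=\Omega_{[n]}$). For a positive integer $\nu$, $\Omega_{\mathcal{J}}$ is called a relaxed $(\nu,r,m)$-SLMF if $$\sum_{j\in\mathcal{J}}\max\{\#(\omega_j\cap\mathcal{I})-r,\,0\}\le\nu(\#\mathcal{I}-r)$$ for every $\mathcal{I}\subset[m]$ with $\#\mathcal{I}\ge r+1$, with equality for $\mathcal{I}=[m]$. *)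

theory Defs
  imports Main "HOL-Library.Disjoint_Sets"
begin

definition Omega :: "(nat \<Rightarrow> nat set) \<Rightarrow> nat set \<Rightarrow> (nat \<times> nat) set" where
  "Omega \<omega> J = (\<Union>j\<in>J. \<omega> j \<times> {j})"

(* relaxed_SLMF nu r m omega J says that the set Omega omega J is a relaxed (nu,r,m)-SLMF.
   The condition refers to the columns omega j with j in J, so these are the arguments.
   It is stated over the integers because # (omega j \<inter> I) - r may be negative. *)
definition relaxed_SLMF ::
    "nat \<Rightarrow> nat \<Rightarrow> nat \<Rightarrow> (nat \<Rightarrow> nat set) \<Rightarrow> nat set \<Rightarrow> bool" where
  "relaxed_SLMF \<nu> r m \<omega> J \<longleftrightarrow>
     (\<forall>I. I \<subseteq> {1..m} \<and> card I \<ge> r + 1 \<longrightarrow>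
        (\<Sum>j\<in>J. max (int (card (\<omega> j \<inter> I)) - int r) 0) \<le> int \<nu> * (int (card I) - int r)) \<and>
     (\<Sum>j\<in>J. max (int (card (\<omega> j \<inter> {1..m})) - int r) 0)
       = int \<nu> * (int (card {1..m}) - int r)"

end

theory Submission imports Defs begin

text \<open>Since every column has r + 1 entries, max (# (\<omega> j \<inter> I) - r) 0 is the indicator of
  \<omega> j \<subseteq> I. So with N(A) = \<Union>j\<in>A. \<omega> j and f A = # N(A) - r, being a relaxed
  (\<nu>,r,m)-SLMF means # A \<le> \<nu> * f A for all nonempty A \<subseteq> J, and # J = \<nu> * (m - r).
  The function f is submodular on intersecting pairs only; its Dilworth truncation g is
  monotone and fully submodular and defines the same inequalities. A discrete sandwich theorem then
  splits a set with # A \<le> (k + 1) * g A into two parts satisfying the inequality with the constants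
  1 and k: the first part is a set S with # A - k * g A \<le> # (A \<inter> S) \<le> g A for all A.\<close>

section \<open>A discrete sandwich theorem\<close>

text \<open>The induction projects out one element e: once it is decided whether e belongs to S,
  the constraints on A and on insert e A merge into one for A, and the new bounds
  satisfy the same hypotheses.\<close>

lemma discrete_sandwich:
  fixes p b :: "'a set \<Rightarrow> int"
  assumes "finite E"
    and "\<And>A B. A \<subseteq> E \<Longrightarrow> B \<subseteq> E \<Longrightarrow> b (A \<union> B) + b (A \<inter> B) \<le> b A + b B"
    and "\<And>A B. A \<subseteq> E \<Longrightarrow> B \<subseteq> E \<Longrightarrow> p A + p B \<le> p (A \<union> B) + p (A \<inter> B)"
    and "\<And>A. A \<subseteq> E \<Longrightarrow> p A \<le> b A"
    and "\<And>A x. A \<subseteq> E \<Longrightarrow> x \<in> E \<Longrightarrow> b A \<le> b (insert x A)"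
    and "\<And>A x. A \<subseteq> E \<Longrightarrow> x \<in> E \<Longrightarrow> p (insert x A) \<le> p A + 1"
    and "0 \<le> p {}" and "b {} \<le> 0"
  shows "\<exists>S\<subseteq>E. \<forall>A\<subseteq>E. p A \<le> int (card (A \<inter> S)) \<and> int (card (A \<inter> S)) \<le> b A"
  using assms
proof (induction E arbitrary: p b rule: finite_induct)
  case empty
  then show ?case by force
next
  case (insert e F)
  note sub = insert.prems(1) and super = insert.prems(2) and le = insert.prems(3)
    and mono = insert.prems(4) and step = insert.prems(5)
  \<comment> \<open>The contribution of \<open>e\<close> to the counts: \<open>y = 1\<close> puts
    \<open>e\<close> into the set. This is done exactly when every upper bound on
    \<open>insert e A\<close> leaves room for \<open>e\<close> above the lower bound on
    \<open>A\<close>.\<close>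
  define y :: int where "y = (if \<forall>A\<subseteq>F. 1 + p A \<le> b (insert e A) then 1 else 0)"
  \<comment> \<open>Once \<open>y\<close> is fixed, the count on \<open>insert e A\<close> is the
    count on \<open>A\<close> plus \<open>y\<close>. A bound on \<open>insert e A\<close> thus
    becomes a bound on \<open>A\<close> shifted by \<open>y\<close>, and the stricter of the two is
    kept.\<close>
  define b' where "b' A = min (b A) (b (insert e A) - y)" for A
  define p' where "p' A = max (p A) (p (insert e A) - y)" for A
  \<comment> \<open>For \<open>p' A \<le> b' A\<close> the comparisons of \<open>p\<close> with
    \<open>b\<close> on \<open>A\<close> and on \<open>insert e A\<close> are given; the two mixed
    ones are \<open>upper\<close> and \<open>lower\<close>.\<close>
  have upper: "p A + y \<le> b (insert e A)" if "A \<subseteq> F" for A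
  proof (cases "\<forall>A\<subseteq>F. 1 + p A \<le> b (insert e A)")
    case True
    then show ?thesis using that by (auto simp: y_def)
  next
    case False
    then have "y = 0" by (simp add: y_def)
    moreover have "p A \<le> b A" "b A \<le> b (insert e A)"
      using that by (auto intro!: le mono)
    ultimately show ?thesis by simp
  qed
  have lower: "p (insert e A) - y \<le> b A" if A: "A \<subseteq> F" for A
  proof (cases "\<forall>A\<subseteq>F. 1 + p A \<le> b (insert e A)")
    case True
    then have "y = 1" by (simp add: y_def)
    moreover have "p A \<le> b A" "p (insert e A) \<le> p A + 1"
      using that by (auto intro!: le step)
    ultimately show ?thesis by simp
  next
    case False
    \<comment> \<open>\<open>B\<close> is a set that forbids \<open>y = 1\<close>. The pairs
      \<open>insert e A\<close>, \<open>B\<close> and \<open>A\<close>, \<open>insert e B\<close>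
      have the same union and the same intersection, so supermodularity of \<open>p\<close> on the
      first and submodularity of \<open>b\<close> on the second can be chained; since
      \<open>b (insert e B) \<le> p B\<close>, the terms with \<open>B\<close> drop out.\<close>
    then obtain B where B: "B \<subseteq> F" "b (insert e B) \<le> p B" by force
    have y: "y = 0" using False by (simp add: y_def)
    have e: "e \<notin> A" "e \<notin> B" using A B insert.hyps by auto
    have sets: "insert e A \<union> B = A \<union> insert e B" "insert e A \<inter> B = A \<inter> insert e B"
      using e by auto
    have "p (insert e A) + p B \<le> p (insert e A \<union> B) + p (insert e A \<inter> B)"
      using A B by (intro super) auto
    also have "\<dots> \<le> b (A \<union> insert e B) + b (A \<inter> insert e B)"
      unfolding sets using A B by (intro add_mono le) auto
    also have "\<dots> \<le> b A + b (insert e B)"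
      using A B by (intro sub) auto
    finally show ?thesis using B y by simp
  qed
  have le': "p' A \<le> b' A" if "A \<subseteq> F" for A
  proof -
    have "p A \<le> b A" "p (insert e A) \<le> b (insert e A)"
      using that by (auto intro!: le)
    then show ?thesis using upper[OF that] lower[OF that] by (simp add: p'_def b'_def)
  qed
  have "\<exists>S\<subseteq>F. \<forall>A\<subseteq>F. p' A \<le> int (card (A \<inter> S)) \<and> int (card (A \<inter> S)) \<le> b' A"
  proof (rule insert.IH)
    fix A B assume AB: "A \<subseteq> F" "B \<subseteq> F"
    then have e: "e \<notin> A" "e \<notin> B" using insert.hyps by auto
    have sets: "insert e A \<union> B = insert e (A \<union> B)" "insert e A \<inter> B = A \<inter> B"
      "A \<union> insert e B = insert e (A \<union> B)" "A \<inter> insert e B = A \<inter> B"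
      "insert e A \<union> insert e B = insert e (A \<union> B)"
      "insert e A \<inter> insert e B = insert e (A \<inter> B)"
      using e by auto
    have AB': "A \<subseteq> insert e F" "B \<subseteq> insert e F"
      "insert e A \<subseteq> insert e F" "insert e B \<subseteq> insert e F" using AB by auto
    \<comment> \<open>The two minima on the right are attained in one of four combinations. In each,
      the matching instance of submodularity produces the same number of copies of \<open>e\<close>,
      hence of \<open>y\<close>, on both sides. Dually for \<open>p'\<close>.\<close>
    show "b' (A \<union> B) + b' (A \<inter> B) \<le> b' A + b' B"
      using sub[OF AB'(1,2)] sub[OF AB'(1,4)] sub[OF AB'(3,2)] sub[OF AB'(3,4)]
      unfolding b'_def sets by linarith
    show "p' A + p' B \<le> p' (A \<union> B) + p' (A \<inter> B)"
      using super[OF AB'(1,2)] super[OF AB'(1,4)] super[OF AB'(3,2)] super[OF AB'(3,4)]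
      unfolding p'_def sets by linarith
  next
    fix A x assume "A \<subseteq> F" "x \<in> F"
    then have "b A \<le> b (insert x A)" "b (insert e A) \<le> b (insert x (insert e A))"
      "p (insert x A) \<le> p A + 1" "p (insert x (insert e A)) \<le> p (insert e A) + 1"
      by (auto intro!: mono step)
    then show "b' A \<le> b' (insert x A)" "p' (insert x A) \<le> p' A + 1"
      unfolding b'_def p'_def insert_commute[of e x] by linarith+
  next
    show "0 \<le> p' {}" "b' {} \<le> 0"
      using insert.prems(6,7) by (auto simp: p'_def b'_def)
  qed (fact le')
  then obtain S where S: "S \<subseteq> F"
    "\<And>A. A \<subseteq> F \<Longrightarrow> p' A \<le> int (card (A \<inter> S)) \<and> int (card (A \<inter> S)) \<le> b' A" by blast
  define T where "T = (if y = 1 then insert e S else S)"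
  have y01: "y = 0 \<or> y = 1" by (simp add: y_def)
  have "e \<notin> S" "finite S" using S(1) insert.hyps finite_subset by auto
  \<comment> \<open>This undoes the projection: the bounds \<open>p'\<close> and \<open>b'\<close>
    at \<open>A - {e}\<close> contain both the bounds for sets without \<open>e\<close> and those
    for sets with \<open>e\<close>.\<close>
  then have cardT: "int (card (A \<inter> T)) = int (card ((A - {e}) \<inter> S)) + (if e \<in> A then y else 0)" for A
  proof -
    have "(A - {e}) \<inter> S = A \<inter> S" using \<open>e \<notin> S\<close> by auto
    then show ?thesis using y01 \<open>e \<notin> S\<close> \<open>finite S\<close> by (auto simp: T_def)
  qed
  have "p A \<le> int (card (A \<inter> T)) \<and> int (card (A \<inter> T)) \<le> b A" if "A \<subseteq> insert e F" for A
  proof (cases "e \<in> A")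
    case True
    then have "insert e (A - {e}) = A" "A - {e} \<subseteq> F" using that by auto
    then show ?thesis using S(2)[of "A - {e}"] that True
      unfolding cardT p'_def b'_def by auto
  next
    case False
    then have "A - {e} = A" "A \<subseteq> F" using that by auto
    then show ?thesis using S(2)[of A] False
      unfolding cardT p'_def b'_def by auto
  qed
  moreover have "T \<subseteq> insert e F" using S(1) by (auto simp: T_def)
  ultimately show ?case by blast
qed

section \<open>Partition into k independent sets of an integral polymatroid\<close>

text \<open>This is integer decomposition for polymatroids, applied to the all-one vector on
  \<open>E\<close>. One class \<open>S\<close> is split off by the sandwich theorem: on subsets of
  \<open>S\<close> the upper bound reads \<open>card A \<le> g A\<close>, and on sets disjoint from
  \<open>S\<close> the lower bound reads \<open>card A \<le> k * g A\<close>, which is the induction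
  hypothesis for \<open>E - S\<close>.\<close>

lemma polymatroid_partition:
  fixes g :: "'a set \<Rightarrow> nat"
  assumes "finite E"
    and "\<And>A B. A \<subseteq> E \<Longrightarrow> B \<subseteq> E \<Longrightarrow> g (A \<union> B) + g (A \<inter> B) \<le> g A + g B"
    and "\<And>A B. A \<subseteq> B \<Longrightarrow> B \<subseteq> E \<Longrightarrow> g A \<le> g B"
    and "g {} = 0"
    and "\<And>A. A \<subseteq> E \<Longrightarrow> card A \<le> k * g A"
  shows "\<exists>J :: nat \<Rightarrow> 'a set. disjoint_family_on J {1..k} \<and> (\<Union>l\<in>{1..k}. J l) = E \<and>
           (\<forall>l\<in>{1..k}. \<forall>A\<subseteq>J l. card A \<le> g A)"
  using assms
proof (induction k arbitrary: E)
  case 0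
  then have "card E = 0" by force
  then have "E = {}" using 0(1) by simp
  then show ?case by (auto simp: disjoint_family_on_def)
next
  case (Suc k)
  note sub = Suc.prems(2) and mono = Suc.prems(3)
  \<comment> \<open>Each of the other \<open>k\<close> classes may contain at most
    \<open>g A\<close> elements of \<open>A\<close>, so \<open>p A\<close> elements at least must go
    to \<open>S\<close>. Supermodularity of \<open>p\<close> comes from modularity of
    \<open>card\<close>; it grows by at most 1 per element because \<open>g\<close> does not
    decrease.\<close>
  define p where "p A = int (card A) - int k * int (g A)" for A
  have "\<exists>S\<subseteq>E. \<forall>A\<subseteq>E. p A \<le> int (card (A \<inter> S)) \<and> int (card (A \<inter> S)) \<le> int (g A)"
  proof (rule discrete_sandwich)
    fix A B assume AB: "A \<subseteq> E" "B \<subseteq> E"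
    then have "finite A" "finite B" using Suc.prems(1) finite_subset by auto
    then have "int (card (A \<union> B)) + int (card (A \<inter> B)) = int (card A) + int (card B)"
      using card_Un_Int[of A B] by simp
    moreover have "int k * int (g (A \<union> B) + g (A \<inter> B)) \<le> int k * int (g A + g B)"
      using sub[OF AB] by (intro mult_left_mono) auto
    ultimately show "p A + p B \<le> p (A \<union> B) + p (A \<inter> B)"
      by (simp add: p_def algebra_simps)
    show "int (g (A \<union> B)) + int (g (A \<inter> B)) \<le> int (g A) + int (g B)"
      using sub[OF AB] by simp
  next
    fix A assume "A \<subseteq> E"
    then have "card A \<le> Suc k * g A" by (rule Suc.prems(5))
    then have "int (card A) \<le> int (Suc k * g A)" by (simp only: of_nat_le_iff)
    then show "p A \<le> int (g A)" by (simp add: p_def algebra_simps)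
  next
    fix A x assume A: "A \<subseteq> E" "x \<in> E"
    then have gm: "g A \<le> g (insert x A)" by (intro mono) auto
    then show "int (g A) \<le> int (g (insert x A))" by simp
    have "int k * int (g A) \<le> int k * int (g (insert x A))"
      using gm by (intro mult_left_mono) auto
    moreover have "card (insert x A) \<le> Suc (card A)"
      using finite_subset[OF A(1) Suc.prems(1)] by (simp add: card_insert_if)
    ultimately show "p (insert x A) \<le> p A + 1" by (simp add: p_def)
  qed (use Suc.prems in \<open>auto simp: p_def\<close>)
  then obtain S where S: "S \<subseteq> E"
    "\<And>A. A \<subseteq> E \<Longrightarrow> p A \<le> int (card (A \<inter> S)) \<and> int (card (A \<inter> S)) \<le> int (g A)" by blast
  have "\<exists>J :: nat \<Rightarrow> 'a set. disjoint_family_on J {1..k} \<and> (\<Union>l\<in>{1..k}. J l) = E - S \<and>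
           (\<forall>l\<in>{1..k}. \<forall>A\<subseteq>J l. card A \<le> g A)"
  proof (rule Suc.IH)
    fix A assume A: "A \<subseteq> E - S"
    then have "A \<subseteq> E" "A \<inter> S = {}" by auto
    then have "int (card A) \<le> int (k * g A)" using S(2)[of A] by (simp add: p_def)
    then show "card A \<le> k * g A" by (simp only: of_nat_le_iff)
  next
    fix A B assume "A \<subseteq> E - S" "B \<subseteq> E - S"
    then show "g (A \<union> B) + g (A \<inter> B) \<le> g A + g B" by (intro sub) auto
  next
    fix A B assume "A \<subseteq> B" "B \<subseteq> E - S"
    then show "g A \<le> g B" by (intro mono) auto
  qed (use Suc.prems in auto)
  then obtain J where J: "disjoint_family_on J {1..k}" "(\<Union>l\<in>{1..k}. J l) = E - S"
    "\<forall>l\<in>{1..k}. \<forall>A\<subseteq>J l. card A \<le> g A"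
    by (elim exE conjE)
  define J' where "J' = J(Suc k := S)"
  have J'_old: "J' l = J l" if "l \<in> {1..k}" for l using that by (simp add: J'_def)
  have J'_new: "J' (Suc k) = S" by (simp add: J'_def)
  have ivl: "{1..Suc k} = insert (Suc k) {1..k}" by auto
  have union: "(\<Union>l\<in>{1..k}. J' l) = E - S" using J(2) J'_old by simp
  have "disjoint_family_on J' {1..k}"
    using J(1) J'_old by (simp add: disjoint_family_on_def)
  moreover have "S \<inter> (\<Union>l\<in>{1..k}. J' l) = {}" unfolding union by blast
  ultimately have "disjoint_family_on J' {1..Suc k}"
    unfolding ivl by (subst disjoint_family_on_insert) (auto simp: J'_new)
  moreover have "(\<Union>l\<in>{1..Suc k}. J' l) = E"
    unfolding ivl using S(1) union by (auto simp: J'_new)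
  moreover have "card A \<le> g A" if "l \<in> {1..Suc k}" "A \<subseteq> J' l" for l A
  proof (cases "l = Suc k")
    case True
    then have "A \<inter> S = A" "A \<subseteq> E" using that S(1) J'_new by auto
    then show ?thesis using S(2)[of A] by simp
  next
    case False
    then have "l \<in> {1..k}" using that by simp
    then show ?thesis using that J(3) J'_old[of l] by simp
  qed
  ultimately show ?case by (intro exI[of _ J']) simp
qed

section \<open>Dilworth truncation\<close>

text \<open>A finite partition is represented only by its total cost, so that proofs can add one
  part at a time. Parts are nonempty, so the empty set costs 0 whatever \<open>f {}\<close>
  is.\<close>

inductive partition_cost :: "('a set \<Rightarrow> nat) \<Rightarrow> 'a set \<Rightarrow> nat \<Rightarrow> bool" for f where
  empty: "partition_cost f {} 0"
| add_part: "partition_cost f A c \<Longrightarrow> Y \<noteq> {} \<Longrightarrow> A \<inter> Y = {} \<Longrightarrow> partition_cost f (A \<union> Y) (c + f Y)"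

definition dilworth_truncation :: "('a set \<Rightarrow> nat) \<Rightarrow> 'a set \<Rightarrow> nat" where
  "dilworth_truncation f A = (LEAST c. partition_cost f A c)"

lemma partition_cost_single: "A \<noteq> {} \<Longrightarrow> partition_cost f A (f A)"
  using partition_cost.add_part[OF partition_cost.empty, of A f] by simp

lemma dilworth_truncation_attained: "partition_cost f A (dilworth_truncation f A)"
  unfolding dilworth_truncation_def
  by (cases "A = {}") (auto intro: LeastI partition_cost.empty partition_cost_single)

lemma dilworth_truncation_le_cost: "partition_cost f A c \<Longrightarrow> dilworth_truncation f A \<le> c"
  unfolding dilworth_truncation_def by (rule Least_le)

lemma dilworth_truncation_empty: "dilworth_truncation f {} = 0"
  using dilworth_truncation_le_cost[OF partition_cost.empty, of f] by simp

lemma dilworth_truncation_le: "A \<noteq> {} \<Longrightarrow> dilworth_truncation f A \<le> f A"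
  by (intro dilworth_truncation_le_cost partition_cost_single)

lemma partition_cost_Un:
  assumes "partition_cost f B d" "partition_cost f A c" "A \<inter> B = {}"
  shows "partition_cost f (A \<union> B) (c + d)"
  using assms
proof (induction rule: partition_cost.induct)
  case empty
  then show ?case by simp
next
  case (add_part B d Y)
  then have "partition_cost f ((A \<union> B) \<union> Y) ((c + d) + f Y)"
    by (intro partition_cost.add_part) auto
  then show ?case by (simp add: Un_assoc add.assoc)
qed

text \<open>Optimal partitions of the two disjoint sets together partition the union.\<close>

lemma dilworth_truncation_Un_le:
  assumes "A \<inter> B = {}"
  shows "dilworth_truncation f (A \<union> B) \<le> dilworth_truncation f A + dilworth_truncation f B"
  using assms
  by (intro dilworth_truncation_le_cost partition_cost_Un dilworth_truncation_attained)

text \<open>An optimal partition of \<open>B\<close> is restricted to \<open>A\<close>: empty traces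
  are dropped, and the others cost no more than the parts they come from.\<close>

lemma dilworth_truncation_mono:
  assumes mono: "\<And>A B. A \<subseteq> B \<Longrightarrow> B \<subseteq> E \<Longrightarrow> f A \<le> f B"
    and "A \<subseteq> B" "B \<subseteq> E"
  shows "dilworth_truncation f A \<le> dilworth_truncation f B"
proof -
  have "dilworth_truncation f (A \<inter> B) \<le> c" if "partition_cost f B c" "B \<subseteq> E" for c B
    using that
  proof (induction rule: partition_cost.induct)
    case empty
    then show ?case by (simp add: dilworth_truncation_empty)
  next
    case (add_part B c Y)
    have "dilworth_truncation f (A \<inter> Y) \<le> f Y"
    proof (cases "A \<inter> Y = {}")
      case True
      then show ?thesis by (simp add: dilworth_truncation_empty)
    next
      case False
      then have "dilworth_truncation f (A \<inter> Y) \<le> f (A \<inter> Y)" by (rule dilworth_truncation_le)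
      also have "\<dots> \<le> f Y" using add_part.prems by (intro mono) auto
      finally show ?thesis .
    qed
    moreover have "dilworth_truncation f (A \<inter> B \<union> A \<inter> Y)
        \<le> dilworth_truncation f (A \<inter> B) + dilworth_truncation f (A \<inter> Y)"
      using add_part.hyps by (intro dilworth_truncation_Un_le) auto
    moreover have "A \<inter> (B \<union> Y) = A \<inter> B \<union> A \<inter> Y" by auto
    ultimately show ?case using add_part by simp
  qed
  from this[OF dilworth_truncation_attained \<open>B \<subseteq> E\<close>] show ?thesis
    using \<open>A \<subseteq> B\<close> by (simp add: Int_absorb2)
qed

text \<open>Uncrossing of a single set \<open>Y\<close> with a partition of \<open>A\<close>, part
  by part. A part that meets \<open>Y\<close> is merged into it, which is paid for by submodularity
  on intersecting pairs; a part that misses \<open>Y\<close> stays a part of the union. As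
  \<open>Y\<close> grows along the way, it must be arbitrary in the induction.\<close>

lemma dilworth_truncation_submodular_part:
  assumes sub: "\<And>X Y. X \<subseteq> E \<Longrightarrow> Y \<subseteq> E \<Longrightarrow> X \<inter> Y \<noteq> {} \<Longrightarrow> f (X \<union> Y) + f (X \<inter> Y) \<le> f X + f Y"
    and "partition_cost f A c" "A \<subseteq> E" "Y \<subseteq> E" "Y \<noteq> {}"
  shows "dilworth_truncation f (A \<union> Y) + dilworth_truncation f (A \<inter> Y) \<le> c + f Y"
  using assms(2-)
proof (induction arbitrary: Y rule: partition_cost.induct)
  case empty
  then show ?case by (simp add: dilworth_truncation_empty dilworth_truncation_le)
next
  case (add_part A c X)
  show ?case
  proof (cases "X \<inter> Y = {}")
    case True
    have "(A \<union> X) \<union> Y = (A \<union> Y) \<union> X" "(A \<union> X) \<inter> Y = A \<inter> Y" using True by auto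
    moreover have "dilworth_truncation f ((A \<union> Y) \<union> X)
        \<le> dilworth_truncation f (A \<union> Y) + dilworth_truncation f X"
      using True add_part.hyps by (intro dilworth_truncation_Un_le) auto
    moreover have "dilworth_truncation f X \<le> f X"
      using add_part.hyps by (intro dilworth_truncation_le)
    ultimately show ?thesis using add_part.IH[of Y] add_part.prems by simp
  next
    case False
    \<comment> \<open>The induction hypothesis is used with \<open>X \<union> Y\<close> in the role
      of \<open>Y\<close>. The trace \<open>X \<inter> Y\<close> is missing from its intersection
      term and is added back by subadditivity.\<close>
    have "A \<union> (X \<union> Y) = (A \<union> X) \<union> Y" "A \<inter> (X \<union> Y) = A \<inter> Y" using add_part.hyps by auto
    then have "dilworth_truncation f ((A \<union> X) \<union> Y) + dilworth_truncation f (A \<inter> Y)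
        \<le> c + f (X \<union> Y)"
      using add_part.IH[of "X \<union> Y"] add_part.prems by simp
    moreover have "dilworth_truncation f ((A \<inter> Y) \<union> (X \<inter> Y))
        \<le> dilworth_truncation f (A \<inter> Y) + dilworth_truncation f (X \<inter> Y)"
      using add_part.hyps by (intro dilworth_truncation_Un_le) auto
    moreover have "(A \<inter> Y) \<union> (X \<inter> Y) = (A \<union> X) \<inter> Y" by auto
    moreover have "dilworth_truncation f (X \<inter> Y) \<le> f (X \<inter> Y)"
      using False by (rule dilworth_truncation_le)
    moreover have "f (X \<union> Y) + f (X \<inter> Y) \<le> f X + f Y"
      using add_part.prems False by (intro sub) auto
    ultimately show ?thesis by simp
  qed
qed

text \<open>The parts of an optimal partition of \<open>B\<close> are added to \<open>A\<close> one
  at a time. Each new part \<open>Y\<close> is uncrossed with an optimal partition of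
  \<open>A \<union> B\<close>, where \<open>B\<close> is the union of the earlier parts; the trace
  \<open>A \<inter> Y\<close> that this yields then joins \<open>A \<inter> B\<close>.\<close>

lemma dilworth_truncation_submodular:
  assumes sub: "\<And>X Y. X \<subseteq> E \<Longrightarrow> Y \<subseteq> E \<Longrightarrow> X \<inter> Y \<noteq> {} \<Longrightarrow> f (X \<union> Y) + f (X \<inter> Y) \<le> f X + f Y"
    and "A \<subseteq> E" "B \<subseteq> E"
  shows "dilworth_truncation f (A \<union> B) + dilworth_truncation f (A \<inter> B)
    \<le> dilworth_truncation f A + dilworth_truncation f B"
proof -
  have "dilworth_truncation f (A \<union> B) + dilworth_truncation f (A \<inter> B)
    \<le> dilworth_truncation f A + d" if "partition_cost f B d" "B \<subseteq> E" for B d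
    using that
  proof (induction rule: partition_cost.induct)
    case empty
    then show ?case by (simp add: dilworth_truncation_empty)
  next
    case (add_part B d Y)
    have "dilworth_truncation f ((A \<union> B) \<union> Y) + dilworth_truncation f ((A \<union> B) \<inter> Y)
        \<le> dilworth_truncation f (A \<union> B) + f Y"
      using \<open>A \<subseteq> E\<close> add_part.prems add_part.hyps
      by (intro dilworth_truncation_submodular_part[OF sub] dilworth_truncation_attained) auto
    moreover have "dilworth_truncation f ((A \<inter> B) \<union> (A \<inter> Y))
        \<le> dilworth_truncation f (A \<inter> B) + dilworth_truncation f (A \<inter> Y)"
      using add_part.hyps by (intro dilworth_truncation_Un_le) auto
    moreover have "(A \<union> B) \<inter> Y = A \<inter> Y" "(A \<inter> B) \<union> (A \<inter> Y) = A \<inter> (B \<union> Y)"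
      "(A \<union> B) \<union> Y = A \<union> (B \<union> Y)"
      using add_part.hyps by auto
    ultimately show ?case using add_part by simp
  qed
  from this[OF dilworth_truncation_attained \<open>B \<subseteq> E\<close>] show ?thesis .
qed

text \<open>The bound holds on every part and adds up over a partition, so it survives the passage
  from \<open>f\<close> to its truncation.\<close>

lemma card_le_dilworth_truncation:
  assumes "finite E" and le: "\<And>A. A \<subseteq> E \<Longrightarrow> A \<noteq> {} \<Longrightarrow> card A \<le> k * f A" and "A \<subseteq> E"
  shows "card A \<le> k * dilworth_truncation f A"
proof -
  have "card A \<le> k * c" if "partition_cost f A c" "A \<subseteq> E" for A c
    using that
  proof (induction rule: partition_cost.induct)
    case empty
    then show ?case by simp
  next
    case (add_part A c Y)
    have "card (A \<union> Y) \<le> card A + card Y" by (rule card_Un_le)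
    also have "\<dots> \<le> k * c + k * f Y" using add_part by (intro add_mono le) auto
    finally show ?case by (simp add: algebra_simps)
  qed
  from this[OF dilworth_truncation_attained \<open>A \<subseteq> E\<close>] show ?thesis .
qed

text \<open>The truncation satisfies the hypotheses of \<open>polymatroid_partition\<close>. The
  resulting bounds carry over to \<open>f\<close> because the truncation lies below \<open>f\<close>
  on nonempty sets.\<close>

theorem intersecting_submodular_partition:
  fixes f :: "'a set \<Rightarrow> nat"
  assumes "finite E"
    and sub: "\<And>X Y. X \<subseteq> E \<Longrightarrow> Y \<subseteq> E \<Longrightarrow> X \<inter> Y \<noteq> {} \<Longrightarrow> f (X \<union> Y) + f (X \<inter> Y) \<le> f X + f Y"
    and mono: "\<And>A B. A \<subseteq> B \<Longrightarrow> B \<subseteq> E \<Longrightarrow> f A \<le> f B"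
    and le: "\<And>A. A \<subseteq> E \<Longrightarrow> A \<noteq> {} \<Longrightarrow> card A \<le> k * f A"
  shows "\<exists>J :: nat \<Rightarrow> 'a set. disjoint_family_on J {1..k} \<and> (\<Union>l\<in>{1..k}. J l) = E \<and>
           (\<forall>l\<in>{1..k}. \<forall>A\<subseteq>J l. A \<noteq> {} \<longrightarrow> card A \<le> f A)"
proof -
  have "\<exists>J :: nat \<Rightarrow> 'a set. disjoint_family_on J {1..k} \<and> (\<Union>l\<in>{1..k}. J l) = E \<and>
           (\<forall>l\<in>{1..k}. \<forall>A\<subseteq>J l. card A \<le> dilworth_truncation f A)"
  proof (rule polymatroid_partition)
    show "dilworth_truncation f (A \<union> B) + dilworth_truncation f (A \<inter> B)
        \<le> dilworth_truncation f A + dilworth_truncation f B" if "A \<subseteq> E" "B \<subseteq> E" for A B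
      using sub that by (rule dilworth_truncation_submodular)
    show "dilworth_truncation f A \<le> dilworth_truncation f B" if "A \<subseteq> B" "B \<subseteq> E" for A B
      using mono that by (rule dilworth_truncation_mono)
    show "card A \<le> k * dilworth_truncation f A" if "A \<subseteq> E" for A
      using \<open>finite E\<close> le that by (rule card_le_dilworth_truncation)
  qed (fact \<open>finite E\<close> dilworth_truncation_empty)+
  then obtain J :: "nat \<Rightarrow> 'a set" where J: "disjoint_family_on J {1..k}" "(\<Union>l\<in>{1..k}. J l) = E"
    "\<And>l A. l \<in> {1..k} \<Longrightarrow> A \<subseteq> J l \<Longrightarrow> card A \<le> dilworth_truncation f A" by blast
  have "card A \<le> f A" if "l \<in> {1..k}" "A \<subseteq> J l" "A \<noteq> {}" for l A
    using J(3)[OF that(1,2)] dilworth_truncation_le[OF that(3)] by (rule order_trans)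
  then show ?thesis using J(1,2) by blast
qed

section \<open>Relaxed SLMFs with columns of size r + 1\<close>

lemma sum_excess_eq_card:
  assumes "finite J" and "\<And>j. j \<in> J \<Longrightarrow> card (\<omega> j) = r + 1"
  shows "(\<Sum>j\<in>J. max (int (card (\<omega> j \<inter> I)) - int r) 0) = int (card {j\<in>J. \<omega> j \<subseteq> I})"
proof -
  have "max (int (card (\<omega> j \<inter> I)) - int r) 0 = (if \<omega> j \<subseteq> I then 1 else 0)" if "j \<in> J" for j
  proof (cases "\<omega> j \<subseteq> I")
    case True
    then show ?thesis using assms(2)[OF that] by (simp add: Int_absorb2)
  next
    case False
    \<comment> \<open>A positive cardinality implies finiteness. A column not contained in
      \<open>I\<close> then meets it in at most \<open>r\<close> elements, and the maximum is
      0.\<close>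
    have "finite (\<omega> j)" using assms(2)[OF that] card_ge_0_finite by force
    moreover have "\<omega> j \<inter> I \<subset> \<omega> j" using False by auto
    ultimately have "card (\<omega> j \<inter> I) < card (\<omega> j)" by (rule psubset_card_mono)
    then show ?thesis using False assms(2)[OF that] by simp
  qed
  then have "(\<Sum>j\<in>J. max (int (card (\<omega> j \<inter> I)) - int r) 0)
      = (\<Sum>j\<in>J. if \<omega> j \<subseteq> I then 1 else 0)" by simp
  also have "\<dots> = int (card {j\<in>J. \<omega> j \<subseteq> I})"
    using assms(1) by (simp add: sum.If_cases Int_def)
  finally show ?thesis .
qed

text \<open>Conditions on row sets become conditions on column sets. From \<open>A\<close> one
  passes to the union of its columns, the smallest \<open>I\<close> containing them all; from
  \<open>I\<close> one passes to all columns inside it, whose union may be smaller than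
  \<open>I\<close> and so gives the sharper bound.\<close>

lemma relaxed_SLMF_iff_card:
  assumes "finite J" and "r < m"
    and "\<And>j. j \<in> J \<Longrightarrow> \<omega> j \<subseteq> {1..m}" and "\<And>j. j \<in> J \<Longrightarrow> card (\<omega> j) = r + 1"
  shows "relaxed_SLMF \<nu> r m \<omega> J \<longleftrightarrow>
    (\<forall>A\<subseteq>J. A \<noteq> {} \<longrightarrow> card A \<le> \<nu> * (card (\<Union>j\<in>A. \<omega> j) - r)) \<and> card J = \<nu> * (m - r)"
proof -
  have sum_eq: "(\<Sum>j\<in>J. max (int (card (\<omega> j \<inter> I)) - int r) 0) = int (card {j\<in>J. \<omega> j \<subseteq> I})" for I
    by (rule sum_excess_eq_card) (use assms in auto)
  have of_nat_bound: "int \<nu> * (int c - int r) = int (\<nu> * (c - r))" if "r + 1 \<le> c" for c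
    using that by (simp add: of_nat_diff)
  have J: "{j \<in> J. \<omega> j \<subseteq> {1..m}} = J" using assms(3) by auto
  have "(\<forall>I. I \<subseteq> {1..m} \<and> card I \<ge> r + 1 \<longrightarrow>
        int (card {j\<in>J. \<omega> j \<subseteq> I}) \<le> int \<nu> * (int (card I) - int r)) \<longleftrightarrow>
      (\<forall>A\<subseteq>J. A \<noteq> {} \<longrightarrow> card A \<le> \<nu> * (card (\<Union>j\<in>A. \<omega> j) - r))" (is "?L \<longleftrightarrow> ?R")
  proof
    assume L: ?L
    show ?R
    proof (intro allI impI)
      fix A assume A: "A \<subseteq> J" "A \<noteq> {}"
      define I where "I = (\<Union>j\<in>A. \<omega> j)"
      have I: "I \<subseteq> {1..m}" using A assms(3) by (auto simp: I_def)
      then have "finite I" by (rule finite_subset) simp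
      obtain j where j: "j \<in> A" using A by auto
      have "card (\<omega> j) \<le> card I" using j \<open>finite I\<close> by (intro card_mono) (auto simp: I_def)
      \<comment> \<open>A nonempty \<open>A\<close> contributes a whole column, so \<open>I\<close>
        is large enough for the condition to apply and the subtraction of \<open>r\<close> is
        exact.\<close>
      then have r: "r + 1 \<le> card I" using j A assms(4) by auto
      have "card A \<le> card {j\<in>J. \<omega> j \<subseteq> I}"
        using A assms(1) by (intro card_mono) (auto simp: I_def)
      moreover have "int (card {j\<in>J. \<omega> j \<subseteq> I}) \<le> int (\<nu> * (card I - r))"
        using L I r of_nat_bound[OF r] by auto
      ultimately show "card A \<le> \<nu> * (card (\<Union>j\<in>A. \<omega> j) - r)"
        unfolding I_def[symmetric] of_nat_le_iff by simp
    qed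
  next
    assume R: ?R
    show ?L
    proof (intro allI impI)
      fix I assume I: "I \<subseteq> {1..m} \<and> card I \<ge> r + 1"
      define A where "A = {j\<in>J. \<omega> j \<subseteq> I}"
      have "card A \<le> \<nu> * (card I - r)"
      proof (cases "A = {}")
        case False
        then have "card A \<le> \<nu> * (card (\<Union>j\<in>A. \<omega> j) - r)" using R by (auto simp: A_def)
        also have "\<dots> \<le> \<nu> * (card I - r)"
          using I finite_subset[of I "{1..m}"]
          by (intro mult_left_mono diff_le_mono card_mono) (auto simp: A_def)
        finally show ?thesis .
      qed simp
      then show "int (card {j\<in>J. \<omega> j \<subseteq> I}) \<le> int \<nu> * (int (card I) - int r)"
        using I of_nat_bound[of "card I"] unfolding A_def[symmetric] by (simp only: of_nat_le_iff)
    qed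
  qed
  moreover have "int (card J) = int \<nu> * (int (card {1..m}) - int r) \<longleftrightarrow> card J = \<nu> * (m - r)"
  proof -
    have "int \<nu> * (int (card {1..m}) - int r) = int (\<nu> * (m - r))"
      using of_nat_bound[of m] assms(2) by simp
    then show ?thesis by (simp only: of_nat_eq_iff)
  qed
  ultimately show ?thesis
    unfolding relaxed_SLMF_def sum_eq J by simp
qed

text \<open>The defining sums add up over disjoint index sets, and so do the right-hand sides. With
  \<open>\<nu> = 1\<close> and \<open>r\<close> classes this gives the step from the partition to
  the whole set.\<close>

lemma relaxed_SLMF_Union:
  assumes "finite K" and "disjoint_family_on J K" and "\<And>l. l \<in> K \<Longrightarrow> finite (J l)"
    and "\<And>l. l \<in> K \<Longrightarrow> relaxed_SLMF \<nu> r m \<omega> (J l)"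
  shows "relaxed_SLMF (card K * \<nu>) r m \<omega> (\<Union>l\<in>K. J l)"
proof -
  have split: "(\<Sum>j\<in>(\<Union>l\<in>K. J l). h j) = (\<Sum>l\<in>K. \<Sum>j\<in>J l. h j)" for h :: "nat \<Rightarrow> int"
    using assms by (intro sum.UNION_disjoint) (auto simp: disjoint_family_on_def)
  show ?thesis
    unfolding relaxed_SLMF_def split
  proof (intro conjI allI impI)
    fix I assume "I \<subseteq> {1..m} \<and> r + 1 \<le> card I"
    then have "(\<Sum>l\<in>K. \<Sum>j\<in>J l. max (int (card (\<omega> j \<inter> I)) - int r) 0)
        \<le> (\<Sum>l\<in>K. int \<nu> * (int (card I) - int r))"
      using assms(4) by (intro sum_mono) (auto simp: relaxed_SLMF_def)
    then show "(\<Sum>l\<in>K. \<Sum>j\<in>J l. max (int (card (\<omega> j \<inter> I)) - int r) 0)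
        \<le> int (card K * \<nu>) * (int (card I) - int r)" by (simp add: mult.assoc)
  next
    have "(\<Sum>l\<in>K. \<Sum>j\<in>J l. max (int (card (\<omega> j \<inter> {1..m})) - int r) 0)
        = (\<Sum>l\<in>K. int \<nu> * (int (card {1..m}) - int r))"
      using assms(4) by (intro sum.cong) (auto simp: relaxed_SLMF_def)
    then show "(\<Sum>l\<in>K. \<Sum>j\<in>J l. max (int (card (\<omega> j \<inter> {1..m})) - int r) 0)
        = int (card K * \<nu>) * (int (card {1..m}) - int r)" by (simp add: mult.assoc)
  qed
qed

text \<open>Rows covered by \<open>A \<inter> B\<close> are covered by both \<open>A\<close> and
  \<open>B\<close>. A common column forces at least \<open>r\<close> such rows, so no subtraction is
  cut off at 0; for disjoint \<open>A\<close> and \<open>B\<close> the intersection term would be 0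
  instead of -r.\<close>

lemma card_neighbourhood_submodular:
  assumes fin: "\<And>j. j \<in> A \<union> B \<Longrightarrow> finite (\<omega> j)" and "finite A" "finite B"
    and ne: "A \<inter> B \<noteq> {}" and card: "\<And>j. j \<in> A \<union> B \<Longrightarrow> r \<le> card (\<omega> j)"
  shows "(card (\<Union>(\<omega> ` (A \<union> B))) - r) + (card (\<Union>(\<omega> ` (A \<inter> B))) - r)
    \<le> (card (\<Union>(\<omega> ` A)) - r) + (card (\<Union>(\<omega> ` B)) - r)"
proof -
  let ?N = "\<lambda>A. \<Union>(\<omega> ` A)"
  have finN: "finite (?N A)" "finite (?N B)" using assms by auto
  have "card (?N A) + card (?N B) = card (?N (A \<union> B)) + card (?N A \<inter> ?N B)"
    using card_Un_Int[OF finN] by (simp add: image_Un)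
  moreover have le: "card (?N (A \<inter> B)) \<le> card (?N A \<inter> ?N B)"
    "card (?N A \<inter> ?N B) \<le> card (?N A)" "card (?N A \<inter> ?N B) \<le> card (?N B)"
    using finN by (auto intro!: card_mono)
  moreover obtain j where j: "j \<in> A \<inter> B" using ne by auto
  have "card (\<omega> j) \<le> card (?N (A \<inter> B))"
    using j finN finite_subset[of "?N (A \<inter> B)" "?N A"] by (intro card_mono) auto
  then have "r \<le> card (?N (A \<inter> B))" using card[of j] j by auto
  ultimately show ?thesis by linarith
qed

section \<open>The column count and the two implications\<close>

theorem proposition3:
  fixes r m n :: nat and \<omega> :: "nat \<Rightarrow> nat set"
  assumes "0 < r" and "r < m" and "m \<le> n"
    and "\<forall>j\<in>{1..n}. \<omega> j \<subseteq> {1..m}"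
    and "card (Omega \<omega> {1..n}) = r * (m + n - r)"
    and "\<forall>j\<in>{1..n}. card (\<omega> j) = r + 1"
  shows "n = r * (m - r) \<and>
    ((\<exists>J :: nat \<Rightarrow> nat set.
        disjoint_family_on J {1..r} \<and> (\<Union>l\<in>{1..r}. J l) = {1..n} \<and>
        (\<forall>l\<in>{1..r}. relaxed_SLMF 1 r m \<omega> (J l)))
      \<longleftrightarrow> relaxed_SLMF r r m \<omega> {1..n})"
proof -
  have \<omega>: "\<omega> j \<subseteq> {1..m}" "card (\<omega> j) = r + 1" "finite (\<omega> j)" if "j \<in> {1..n}" for j
    using assms(4,6) that finite_subset[of "\<omega> j" "{1..m}"] by auto
  \<comment> \<open>Counting entries by columns gives \<open>n * (r + 1)\<close>; compared with the
    prescribed size, \<open>r * n\<close> cancels.\<close>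
  have "card (Omega \<omega> {1..n}) = (\<Sum>j\<in>{1..n}. card (\<omega> j \<times> {j}))"
    unfolding Omega_def using \<omega>(3) by (intro card_UN_disjoint) auto
  also have "\<dots> = (\<Sum>j\<in>{1..n}. r + 1)"
    using \<omega>(2) by (intro sum.cong) (auto simp: card_cartesian_product)
  finally have "n * (r + 1) = r * (m + n - r)" using assms(5) by simp
  moreover have "m + n - r = (m - r) + n" using assms(2) by simp
  ultimately have n: "n = r * (m - r)" by (simp add: algebra_simps)
  have "\<exists>J :: nat \<Rightarrow> nat set. disjoint_family_on J {1..r} \<and> (\<Union>l\<in>{1..r}. J l) = {1..n} \<and>
      (\<forall>l\<in>{1..r}. relaxed_SLMF 1 r m \<omega> (J l))"
    if slmf: "relaxed_SLMF r r m \<omega> {1..n}"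
  proof -
    define f where "f A = card (\<Union>j\<in>A. \<omega> j) - r" for A
    have bound: "card A \<le> r * f A" if "A \<subseteq> {1..n}" "A \<noteq> {}" for A
      using slmf that relaxed_SLMF_iff_card[of "{1..n}" r m \<omega> r] \<omega> assms(2)
      unfolding f_def by auto
    have "\<exists>J :: nat \<Rightarrow> nat set. disjoint_family_on J {1..r} \<and> (\<Union>l\<in>{1..r}. J l) = {1..n} \<and>
           (\<forall>l\<in>{1..r}. \<forall>A\<subseteq>J l. A \<noteq> {} \<longrightarrow> card A \<le> f A)"
    proof (rule intersecting_submodular_partition)
      fix X Y :: "nat set" assume XY: "X \<subseteq> {1..n}" "Y \<subseteq> {1..n}" "X \<inter> Y \<noteq> {}"
      show "f (X \<union> Y) + f (X \<inter> Y) \<le> f X + f Y"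
        unfolding f_def
      proof (rule card_neighbourhood_submodular)
        show "finite X" "finite Y" using XY(1,2) by (auto intro: finite_subset)
        show "X \<inter> Y \<noteq> {}" by fact
        fix j assume "j \<in> X \<union> Y"
        then have "j \<in> {1..n}" using XY by auto
        then show "finite (\<omega> j)" "r \<le> card (\<omega> j)" using \<omega>(2,3) by simp_all
      qed
    next
      fix A B :: "nat set" assume AB: "A \<subseteq> B" "B \<subseteq> {1..n}"
      then have "finite B" by (auto intro: finite_subset)
      then show "f A \<le> f B"
        unfolding f_def using AB \<omega>(3) by (intro diff_le_mono card_mono) auto
    qed (use bound in auto)
    then obtain J :: "nat \<Rightarrow> nat set" where J: "disjoint_family_on J {1..r}"
      "(\<Union>l\<in>{1..r}. J l) = {1..n}"
      "\<forall>l\<in>{1..r}. \<forall>A\<subseteq>J l. A \<noteq> {} \<longrightarrow> card A \<le> f A"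
      by (elim exE conjE)
    have Jsub: "J l \<subseteq> {1..n}" if "l \<in> {1..r}" for l using J(2) that by blast
    have Jfin: "finite (J l)" if "l \<in> {1..r}" for l
      using finite_subset[OF Jsub[OF that]] by simp
    \<comment> \<open>The partition provides only inequalities. Equality for all rows follows by
      counting: each class has at most \<open>m - r\<close> columns, and the \<open>r\<close>
      classes together have \<open>n = r * (m - r)\<close>, so none can have fewer.\<close>
    have Jle: "card (J l) \<le> m - r" if l: "l \<in> {1..r}" for l
    proof (cases "J l = {}")
      case False
      then have "card (J l) \<le> f (J l)" using J(3) l by simp
      also have "card (\<Union>j\<in>J l. \<omega> j) \<le> card {1..m}"
        using Jsub[OF l] \<omega>(1) by (intro card_mono) blast+
      then have "f (J l) \<le> m - r" unfolding f_def by simp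
      finally show ?thesis .
    qed simp
    have "n = card (\<Union>l\<in>{1..r}. J l)" using J(2) by simp
    also have "\<dots> = (\<Sum>l\<in>{1..r}. card (J l))"
      using J(1) Jfin by (intro card_UN_disjoint) (auto simp: disjoint_family_on_def)
    finally have total: "(\<Sum>l\<in>{1..r}. card (J l)) = (\<Sum>l\<in>{1..r}. m - r)" using n by simp
    have Jeq: "card (J l) = m - r" if "l \<in> {1..r}" for l
      using sum_mono_inv[OF total Jle that] by simp
    have "relaxed_SLMF 1 r m \<omega> (J l)" if l: "l \<in> {1..r}" for l
    proof -
      have "relaxed_SLMF 1 r m \<omega> (J l) \<longleftrightarrow>
        (\<forall>A\<subseteq>J l. A \<noteq> {} \<longrightarrow> card A \<le> 1 * (card (\<Union>j\<in>A. \<omega> j) - r)) \<and> card (J l) = 1 * (m - r)"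
        using Jfin[OF l] assms(2) \<omega>(1,2) Jsub[OF l] by (intro relaxed_SLMF_iff_card) blast+
      then show ?thesis using J(3) l Jeq[OF l] by (simp add: f_def)
    qed
    then show ?thesis using J(1,2) by (intro exI[of _ J]) simp
  qed
  moreover have "relaxed_SLMF r r m \<omega> {1..n}"
    if "disjoint_family_on J {1..r}" "(\<Union>l\<in>{1..r}. J l) = {1..n}"
      "\<forall>l\<in>{1..r}. relaxed_SLMF 1 r m \<omega> (J l)" for J
  proof -
    have "finite (J l)" if "l \<in> {1..r}" for l
      using \<open>(\<Union>l\<in>{1..r}. J l) = {1..n}\<close> that finite_subset[of "J l" "{1..n}"] by blast
    then show ?thesis using relaxed_SLMF_Union[of "{1..r}" J 1 r m \<omega>] that by simp
  qed
  ultimately show ?thesis using n by blast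
qed

end
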